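(* Let $r_p, h_p, r_v, a_{lo}, a_{max}$ be real parameters and $r,h,v,w,v_{lo}$ real state variables. The following differential game logic formula is valid (true in every state): $$\Big(r_p\ge 0\wedge h_p>0\wedge r_v\ge 0\wedge a_{lo}>0\wedge (w=-1\vee w=1)\wedge a_{max}\ge a_{lo}\wedge L^{-1}_{impl}(r,h,v,w,v_{lo})\Big)\ \to\ [\alpha_1^*]\big(|r|>r_p\vee |h|>h_p\big),$$ where $$\alpha_1 \equiv \Big(?\mathit{true}\ \cup\ \big((w:=1\cup w:=-1);\ v_{lo}:=*;\ ?L^{-1}_{impl}(r,h,v,w,v_{lo});\ \mathit{adv}:=(w,v_{lo})\big)\Big);\ \big(a_o:=*;\ ?(-a_{max}\le a_o\le a_{max})\big)^d;\ \{r'=-r_v,\ h'=-v,\ v'=a_o\}.$$ That is, from every state satisfying the precondition, the ownship has a winning strategy in this game that guarantees $|r|>r_p\vee|h|>h_p$ (no near mid-air collision) throughout.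
   Context: Game semantics (differential game logic dGL). A hybrid game is played between the ownship (the player who must establish the postcondition) and the opponent. A formula $P\to[\alpha]Q$ is valid iff from every state (assignment of reals to all variables) satisfying $P$ the ownship has a strategy in game $\alpha$ such that every play it allows ends (whenever it ends) in a state satisfying $Q$. Game constructs: $x:=e$ assigns the value of $e$ to $x$; $x:=*$ lets the opponent pick an arbitrary real value for $x$; $?\phi$ is a test: if $\phi$ is false in the current state the opponent loses; $\alpha;\beta$ plays $\alpha$ then $\beta$; $\alpha\cup\beta$ lets the opponent choose which of $\alpha,\beta$ to play; $\alpha^*$ lets the opponent decide, before each round, whether to play another round of $\alpha$ or stop (so $Q$ must hold after every finite number of rounds the opponent may choose, including zero); $\{x'=f(x)\ \&\ D\}$ evolves the variables along the solution of the differential equations for a nonnegative duration chosen by the opponent, such that $D$ holds throughout (no domain means $D\equiv\mathit{true}$); $\alpha^d$ (dual) swaps the roles inside $\alpha$: there the ownship makes all choices (e.g. the value in $x:=*$), and a failed test makes the ownship lose. The assignment $\mathit{adv}:=(w,v_{lo})$ is a bookkeeping assignment to a variable not occurring elsewhere. Interpretation: $r$ horizontal and $h$ vertical separation of the intruder relative to the ownship, $v$ relative vertical velocity, $r_v$ horizontal closure rate, $a_o$ ownship vertical acceleration, $(w,v_{lo})$ the advisory (direction $w=\pm1$, target relative climb rate $v_{lo}$), $a_{lo}$ minimal advisory-compliant acceleration, $a_{max}$ ownship acceleration limit, $r_p,h_p$ puck radius and half-height. Safe region: $T_{lo}(v,w,v_{lo})\equiv \frac{\max(0,w(v_{lo}-v))}{a_{lo}}$;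 $A_{lo}(v,w,v_{lo},h_n,t)\equiv \big(0\le t<T_{lo}(v,w,v_{lo})\wedge h_n=\frac{w a_{lo}}{2}t^2+vt\big)\vee\big(t\ge T_{lo}(v,w,v_{lo})\wedge h_n=v_{lo}t-\frac{w\max(0,w(v_{lo}-v))^2}{2a_{lo}}\big)$; $L^{-1}_{impl}(r,h,v,w,v_{lo})\equiv \forall t\,\forall r_n\,\forall h_n\big(r_n=r_v t\wedge A_{lo}(v,w,v_{lo},h_n,t)\to(|r-r_n|>r_p\vee w(h_n-h)>h_p)\big)$, where $r_v,a_{lo},r_p,h_p$ are the parameters above. *)

theory Defs
  imports Complex_Main
begin

text \<open>Hybrid games of differential game logic. Terms and formulas are represented by their
  meaning, i.e. as functions on states.\<close>

type_synonym 'v state = "'v \<Rightarrow> real"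
type_synonym 'v trm = "'v state \<Rightarrow> real"
type_synonym 'v fml = "'v state \<Rightarrow> bool"

datatype 'v game =
    Assign 'v "'v trm"
  | AssignAny 'v
  | Test "'v fml"
  | Evolve "'v \<Rightarrow> 'v trm option" "'v fml"
  | Choice "'v game" "'v game"
  | Seq "'v game" "'v game"
  | Star "'v game"
  | Dual "'v game"

text \<open>\<open>solution f D T \<phi>\<close>: on the time interval from 0 to T the flow \<open>\<phi>\<close> solves the system with
  equations \<open>x' = e\<close> for \<open>f x = Some e\<close>, stays in \<open>D\<close>, and leaves all other variables constant.\<close>

definition solution ::
    "('v \<Rightarrow> 'v trm option) \<Rightarrow> 'v fml \<Rightarrow> real \<Rightarrow> (real \<Rightarrow> 'v state) \<Rightarrow> bool" where
  "solution f D T \<phi> \<longleftrightarrow> 0 \<le> T \<and> (\<forall>t\<in>{0..T}. D (\<phi> t) \<and>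
     (\<forall>x. case f x of
            Some e \<Rightarrow> ((\<lambda>\<tau>. \<phi> \<tau> x) has_real_derivative e (\<phi> t)) (at t within {0..T})
          | None \<Rightarrow> \<phi> t x = \<phi> 0 x))"

datatype player = Ownship | Opponent

fun other :: "player \<Rightarrow> player" where
  "other Ownship = Opponent"
| "other Opponent = Ownship"

text \<open>A position consists of the games that remain to be played, each tagged with the player who
  makes the choices in it, and the current state. The play has ended when no game remains.\<close>

type_synonym 'v position = "(player \<times> 'v game) list \<times> 'v state"

fun to_move :: "player \<Rightarrow> 'v position \<Rightarrow> bool" where
  "to_move p ([], s) \<longleftrightarrow> False"
| "to_move p ((q, \<alpha>) # K, s) \<longleftrightarrow> p = q"

text \<open>Legal moves. A player who has to move but has no legal move loses; this is how a player
  loses at a failed test (or when an evolution starts outside its domain).\<close>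

inductive move :: "'v position \<Rightarrow> 'v position \<Rightarrow> bool" where
  assign: "move ((p, Assign x e) # K, s) (K, s(x := e s))"
| assign_any: "move ((p, AssignAny x) # K, s) (K, s(x := c))"
| test: "\<phi> s \<Longrightarrow> move ((p, Test \<phi>) # K, s) (K, s)"
| evolve: "solution f D T \<phi> \<Longrightarrow> \<phi> 0 = s \<Longrightarrow> move ((p, Evolve f D) # K, s) (K, \<phi> T)"
| choice_left: "move ((p, Choice \<alpha> \<beta>) # K, s) ((p, \<alpha>) # K, s)"
| choice_right: "move ((p, Choice \<alpha> \<beta>) # K, s) ((p, \<beta>) # K, s)"
| seq: "move ((p, Seq \<alpha> \<beta>) # K, s) ((p, \<alpha>) # (p, \<beta>) # K, s)"
| star_stop: "move ((p, Star \<alpha>) # K, s) (K, s)"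
| star_repeat: "move ((p, Star \<alpha>) # K, s) ((p, \<alpha>) # (p, Star \<alpha>) # K, s)"
| dual: "move ((p, Dual \<alpha>) # K, s) ((other p, \<alpha>) # K, s)"

text \<open>An ownship strategy maps a play so far (a list of positions, most recent first) to the
  next position.\<close>

type_synonym 'v strategy = "'v position list \<Rightarrow> 'v position"

inductive play :: "'v strategy \<Rightarrow> 'v position \<Rightarrow> 'v position list \<Rightarrow> bool"
  for \<sigma> :: "'v strategy" and c0 :: "'v position" where
  start: "play \<sigma> c0 [c0]"
| opponent: "play \<sigma> c0 (c # h) \<Longrightarrow> to_move Opponent c \<Longrightarrow> move c c' \<Longrightarrow> play \<sigma> c0 (c' # c # h)"
| ownship: "play \<sigma> c0 (c # h) \<Longrightarrow> to_move Ownship c \<Longrightarrow> move c (\<sigma> (c # h)) \<Longrightarrow>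
    play \<sigma> c0 (\<sigma> (c # h) # c # h)"

text \<open>The strategy must always provide a legal move when it is the ownship's turn, so the ownship
  never gets stuck, and every play that ends must do so in \<open>Q\<close>. Plays that never end are not
  losses for the ownship; this is the convention of differential game logic for loops controlled
  by the opponent, i.e. loops not in the scope of an odd number of duals.\<close>

definition winning :: "'v strategy \<Rightarrow> 'v position \<Rightarrow> 'v fml \<Rightarrow> bool" where
  "winning \<sigma> c0 Q \<longleftrightarrow> (\<forall>c h. play \<sigma> c0 (c # h) \<longrightarrow>
     (to_move Ownship c \<longrightarrow> move c (\<sigma> (c # h))) \<and> (\<forall>s. c = ([], s) \<longrightarrow> Q s))"

definition box :: "'v game \<Rightarrow> 'v fml \<Rightarrow> 'v fml" where
  "box \<alpha> Q s \<longleftrightarrow> (\<exists>\<sigma>. winning \<sigma> ([(Opponent, \<alpha>)], s) Q)"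

definition valid :: "'v fml \<Rightarrow> bool" where
  "valid P \<longleftrightarrow> (\<forall>s. P s)"

text \<open>The collision avoidance game. The advisory \<open>adv\<close> is a pair, stored in the two variables
  \<open>Adv_w\<close> and \<open>Adv_vlo\<close>. The parameters \<open>rp\<close>, \<open>hp\<close>, \<open>rv\<close>, \<open>alo\<close>, \<open>amax\<close> never change during
  the game and are therefore ordinary real numbers rather than state variables.\<close>

datatype var = Var_r | Var_h | Var_v | Var_w | Var_vlo | Var_ao | Adv_w | Adv_vlo

definition T_lo :: "real \<Rightarrow> real \<Rightarrow> real \<Rightarrow> real \<Rightarrow> real" where
  "T_lo alo v w vlo = max 0 (w * (vlo - v)) / alo"

definition A_lo :: "real \<Rightarrow> real \<Rightarrow> real \<Rightarrow> real \<Rightarrow> real \<Rightarrow> real \<Rightarrow> bool" where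
  "A_lo alo v w vlo hn t \<longleftrightarrow>
     (0 \<le> t \<and> t < T_lo alo v w vlo \<and> hn = w * alo / 2 * t\<^sup>2 + v * t) \<or>
     (t \<ge> T_lo alo v w vlo \<and> hn = vlo * t - w * (max 0 (w * (vlo - v)))\<^sup>2 / (2 * alo))"

definition L_impl :: "real \<Rightarrow> real \<Rightarrow> real \<Rightarrow> real \<Rightarrow> var fml" where
  "L_impl rp hp rv alo s \<longleftrightarrow>
     (\<forall>t rn hn. rn = rv * t \<and> A_lo alo (s Var_v) (s Var_w) (s Var_vlo) hn t \<longrightarrow>
        \<bar>s Var_r - rn\<bar> > rp \<or> s Var_w * (hn - s Var_h) > hp)"

definition alpha1 :: "real \<Rightarrow> real \<Rightarrow> real \<Rightarrow> real \<Rightarrow> real \<Rightarrow> var game" where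
  "alpha1 rp hp rv alo amax =
     Seq
       (Choice
         (Test (\<lambda>s. True))
         (Seq (Choice (Assign Var_w (\<lambda>s. 1)) (Assign Var_w (\<lambda>s. -1)))
         (Seq (AssignAny Var_vlo)
         (Seq (Test (L_impl rp hp rv alo))
         (Seq (Assign Adv_w (\<lambda>s. s Var_w)) (Assign Adv_vlo (\<lambda>s. s Var_vlo)))))))
    (Seq
       (Dual (Seq (AssignAny Var_ao) (Test (\<lambda>s. -amax \<le> s Var_ao \<and> s Var_ao \<le> amax))))
       (Evolve [Var_r \<mapsto> \<lambda>s. -rv, Var_h \<mapsto> \<lambda>s. - s Var_v, Var_v \<mapsto> \<lambda>s. s Var_ao] (\<lambda>s. True)))"

end

theory Submission imports Defs begin

text \<open>The ownship always chooses the acceleration \<open>w * alo\<close>. Measured in the direction \<open>w\<close>, this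
  never does worse than the nominal trajectory \<open>A_lo\<close>: it follows it until the target rate is
  reached and overtakes it afterwards. Hence \<open>L_impl\<close>, restricted to the future of the current
  moment, stays true along every flow, no matter when the opponent stops it, and is a loop
  invariant together with \<open>w = \<plusminus>1\<close>. At time \<open>0\<close> it gives the separation. On the game side, a
  set of positions that is closed under opponent moves, and from which the ownship can always move
  back into the set, yields a positional winning strategy.\<close>

section \<open>Safe positions\<close>

text \<open>The greatest fixed point admits infinite plays, which the ownship does not lose. A stuck
  opponent satisfies the second rule vacuously; a stuck ownship satisfies no rule.\<close>

coinductive safe :: "'v fml \<Rightarrow> 'v position \<Rightarrow> bool" for Q where
  safe_end: "Q s \<Longrightarrow> safe Q ([], s)"
| safe_opponent: "to_move Opponent c \<Longrightarrow> (\<And>c'. move c c' \<Longrightarrow> safe Q c') \<Longrightarrow> safe Q c"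
| safe_ownship: "to_move Ownship c \<Longrightarrow> move c c' \<Longrightarrow> safe Q c' \<Longrightarrow> safe Q c"

lemma to_move_unique: "to_move p c \<Longrightarrow> to_move q c \<Longrightarrow> p = q"
  by (cases "(p, c)" rule: to_move.cases) auto

text \<open>The strategy reads only the latest position and picks some safe successor; induction
  over plays keeps every reached position safe.\<close>

lemma safe_imp_winning:
  assumes "safe Q c0"
  shows "\<exists>\<sigma>. winning \<sigma> c0 Q"
proof -
  define \<sigma> where "\<sigma> h = (SOME c'. move (hd h) c' \<and> safe Q c')" for h :: "'a position list"
  have own: "move c (\<sigma> (c # h)) \<and> safe Q (\<sigma> (c # h))" if "safe Q c" "to_move Ownship c" for c h
  proof -
    have "\<exists>c'. move c c' \<and> safe Q c'"
      using that by cases (auto dest: to_move_unique)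
    then show ?thesis
      unfolding \<sigma>_def list.sel by (rule someI_ex)
  qed
  have opp: "safe Q c'" if "safe Q c" "to_move Opponent c" "move c c'" for c c'
    using that by cases (auto dest: to_move_unique)
  have "play \<sigma> c0 h \<Longrightarrow> safe Q (hd h)" for h
    by (induction rule: play.induct) (use assms own opp in auto)
  then have safe: "safe Q c" if "play \<sigma> c0 (c # h)" for c h
    using that by fastforce
  have "Q s" if "safe Q ([], s)" for s
    using that by cases auto
  with own safe show ?thesis
    unfolding winning_def by blast
qed

section \<open>Safety rules for the game constructs\<close>

inductive_cases move_AssignE: "move ((p, Assign x e) # K, s) c"
inductive_cases move_AssignAnyE: "move ((p, AssignAny x) # K, s) c"
inductive_cases move_TestE: "move ((p, Test \<phi>) # K, s) c"
inductive_cases move_EvolveE: "move ((p, Evolve f D) # K, s) c"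
inductive_cases move_ChoiceE: "move ((p, Choice \<alpha> \<beta>) # K, s) c"
inductive_cases move_SeqE: "move ((p, Seq \<alpha> \<beta>) # K, s) c"
inductive_cases move_StarE: "move ((p, Star \<alpha>) # K, s) c"
inductive_cases move_DualE: "move ((p, Dual \<alpha>) # K, s) c"

text \<open>Like \<open>Dual\<close> and \<open>Assign\<close>, \<open>Seq\<close> leaves exactly
  one move, so a single rule serves both players.\<close>

lemma safe_Seq:
  "safe Q ((p, \<alpha>) # (p, \<beta>) # K, s) \<Longrightarrow> safe Q ((p, Seq \<alpha> \<beta>) # K, s)"
  by (cases p) (auto intro: safe_ownship safe_opponent seq elim!: move_SeqE)

lemma safe_Dual:
  "safe Q ((other p, \<alpha>) # K, s) \<Longrightarrow> safe Q ((p, Dual \<alpha>) # K, s)"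
  by (cases p) (auto intro: safe_ownship[OF _ dual] safe_opponent elim!: move_DualE)

lemma safe_Assign:
  "safe Q (K, s(x := e s)) \<Longrightarrow> safe Q ((p, Assign x e) # K, s)"
  by (cases p) (auto intro: safe_ownship assign safe_opponent elim!: move_AssignE)

lemma safe_AssignAny_Opponent:
  "(\<And>c. safe Q (K, s(x := c))) \<Longrightarrow> safe Q ((Opponent, AssignAny x) # K, s)"
  by (auto intro: safe_opponent elim!: move_AssignAnyE)

lemma safe_AssignAny_Ownship:
  "safe Q (K, s(x := c)) \<Longrightarrow> safe Q ((Ownship, AssignAny x) # K, s)"
  by (auto intro: safe_ownship assign_any)

text \<open>A failed test leaves the opponent without a move, so \<phi> may be assumed.\<close>

lemma safe_Test_Opponent:
  "(\<phi> s \<Longrightarrow> safe Q (K, s)) \<Longrightarrow> safe Q ((Opponent, Test \<phi>) # K, s)"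
  by (auto intro: safe_opponent elim!: move_TestE)

lemma safe_Test_Ownship:
  "\<phi> s \<Longrightarrow> safe Q (K, s) \<Longrightarrow> safe Q ((Ownship, Test \<phi>) # K, s)"
  by (auto intro: safe_ownship test)

lemma safe_Choice_Opponent:
  "safe Q ((Opponent, \<alpha>) # K, s) \<Longrightarrow> safe Q ((Opponent, \<beta>) # K, s) \<Longrightarrow>
    safe Q ((Opponent, Choice \<alpha> \<beta>) # K, s)"
  by (auto intro: safe_opponent elim!: move_ChoiceE)

lemma safe_Evolve_Opponent:
  "(\<And>T \<phi>. solution f D T \<phi> \<Longrightarrow> \<phi> 0 = s \<Longrightarrow> safe Q (K, \<phi> T)) \<Longrightarrow>
    safe Q ((Opponent, Evolve f D) # K, s)"
  by (auto intro: safe_opponent elim!: move_EvolveE)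

section \<open>Loops controlled by the opponent\<close>

lemma move_append:
  assumes "move (L, s) (L', s')"
  shows "move (L @ M, s) (L' @ M, s')"
  using assms by cases (auto intro: move.intros)

text \<open>A move rewrites only the head of the stack, so with a nonempty front part the games in
  \<open>M\<close> stay untouched. Together with \<open>move_append\<close> this transfers play of a
  loop body to play above the pending loop.\<close>

lemma move_appendE:
  assumes "move (g # L @ M, s) c"
  obtains L' s' where "c = (L' @ M, s')" "move (g # L, s) (L', s')"
  using assms
proof cases
  case (seq p \<alpha> \<beta>)
  then show ?thesis
    by (intro that[of "(p, \<alpha>) # (p, \<beta>) # L" s]) (auto intro: move.intros)
next
  case (star_repeat p \<alpha>)
  then show ?thesis
    by (intro that[of "(p, \<alpha>) # (p, Star \<alpha>) # L" s]) (auto intro: move.intros)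
next
  case (choice_left p \<alpha> \<beta>)
  then show ?thesis
    by (intro that[of "(p, \<alpha>) # L" s]) (auto intro: move.intros)
next
  case (choice_right p \<alpha> \<beta>)
  then show ?thesis
    by (intro that[of "(p, \<beta>) # L" s]) (auto intro: move.intros)
next
  case (dual p \<alpha>)
  then show ?thesis
    by (intro that[of "(other p, \<alpha>) # L" s]) (auto intro: move.intros)
qed (auto intro: that move.intros)

lemma safe_Star_Opponent:
  assumes "I s"
    and body: "\<And>s. I s \<Longrightarrow> safe I ([(Opponent, \<alpha>)], s)"
    and post: "\<And>s. I s \<Longrightarrow> Q s"
  shows "safe Q ([(Opponent, Star \<alpha>)], s)"
proof -
  \<comment> \<open>The coinduction set: a position of the body that is safe for the invariant,
    stacked on the pending loop. Once the body is used up, \<open>I\<close> holds, which covers both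
    stopping and repeating.\<close>
  define X where "X c \<longleftrightarrow> (\<exists>L s. c = (L @ [(Opponent, Star \<alpha>)], s) \<and> safe I (L, s))"
    for c :: "'a position"
  have "X ([(Opponent, Star \<alpha>)], s)"
    using \<open>I s\<close> by (auto simp: X_def intro: safe_end)
  then show ?thesis
  proof (coinduct rule: safe.coinduct[consumes 1, case_names safe])
    case (safe c)
    then obtain L s where c: "c = (L @ [(Opponent, Star \<alpha>)], s)" and L: "safe I (L, s)"
      by (auto simp: X_def)
    show ?case
    proof (cases L)
      case Nil
      with L have "I s"
        by (auto elim: safe.cases)
      have "X ([(Opponent, \<alpha>), (Opponent, Star \<alpha>)], s)"
        unfolding X_def using body[OF \<open>I s\<close>] by (intro exI[of _ "[(Opponent, \<alpha>)]"]) auto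
      moreover have "safe Q ([], s)"
        using post[OF \<open>I s\<close>] by (rule safe_end)
      ultimately show ?thesis
        using Nil c by (auto elim!: move_StarE)
    next
      case (Cons g L')
      obtain q \<beta> where g: "g = (q, \<beta>)"
        by fastforce
      from L show ?thesis
      proof cases
        case safe_end
        then show ?thesis using Cons by simp
      next
        case safe_opponent
        then have "X c'" if "move c c'" for c'
          using that unfolding c Cons X_def by (auto elim!: move_appendE)
        moreover have "to_move Opponent c"
          using safe_opponent by (simp add: c Cons g)
        ultimately show ?thesis by blast
      next
        case (safe_ownship c')
        obtain L1 s1 where c': "c' = (L1, s1)" by fastforce
        have "move c (L1 @ [(Opponent, Star \<alpha>)], s1)"
          using safe_ownship unfolding c c' by (intro move_append)
        moreover have "X (L1 @ [(Opponent, Star \<alpha>)], s1)"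
          using safe_ownship unfolding X_def c' by auto
        moreover have "to_move Ownship c"
          using safe_ownship by (simp add: c Cons g)
        ultimately show ?thesis by blast
      qed
    qed
  qed
qed

section \<open>Flows and the safe region\<close>

lemma zero_deriv_constant:
  fixes f :: "real \<Rightarrow> real"
  assumes "\<And>t. t \<in> {0..T} \<Longrightarrow> (f has_real_derivative 0) (at t within {0..T})" "0 \<le> T"
  shows "f T = f 0"
proof (cases "T = 0")
  case False
  show ?thesis
  proof (rule DERIV_isconst_end[where f = f])
    show "0 < T"
      using False assms(2) by simp
    show "continuous_on {0..T} f"
      using assms(1) by (rule DERIV_continuous_on)
    fix t
    assume "0 < t" "t < T"
    then show "DERIV f t :> 0"
      using assms(1)[of t] by (simp add: at_within_Icc_at)
  qed
qed simp

text \<open>For \<open>v\<close>, \<open>h\<close> and \<open>r\<close>, the difference from the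
  closed form has derivative \<open>0\<close>. The velocity comes first and at all times, since the
  derivative of the height depends on it.\<close>

lemma flow_solution:
  assumes "solution [Var_r \<mapsto> \<lambda>s. -rv, Var_h \<mapsto> \<lambda>s. - s Var_v, Var_v \<mapsto> \<lambda>s. s Var_ao] D T \<phi>"
  shows "\<phi> T Var_v = \<phi> 0 Var_v + \<phi> 0 Var_ao * T"
    and "\<phi> T Var_h = \<phi> 0 Var_h - (\<phi> 0 Var_v * T + \<phi> 0 Var_ao / 2 * T\<^sup>2)"
    and "\<phi> T Var_r = \<phi> 0 Var_r - rv * T"
    and "\<phi> T Var_w = \<phi> 0 Var_w"
    and "\<phi> T Var_vlo = \<phi> 0 Var_vlo"
    and "0 \<le> T"
proof -
  have T: "0 \<le> T"
    and const: "\<And>x t. t \<in> {0..T} \<Longrightarrow> x \<notin> {Var_r, Var_h, Var_v} \<Longrightarrow> \<phi> t x = \<phi> 0 x"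
    and r': "\<And>t. t \<in> {0..T} \<Longrightarrow>
      ((\<lambda>\<tau>. \<phi> \<tau> Var_r) has_real_derivative -rv) (at t within {0..T})"
    and h': "\<And>t. t \<in> {0..T} \<Longrightarrow>
      ((\<lambda>\<tau>. \<phi> \<tau> Var_h) has_real_derivative - \<phi> t Var_v) (at t within {0..T})"
    and v': "\<And>t. t \<in> {0..T} \<Longrightarrow>
      ((\<lambda>\<tau>. \<phi> \<tau> Var_v) has_real_derivative \<phi> t Var_ao) (at t within {0..T})"
    using assms unfolding solution_def
    by (force split: option.splits if_splits)+
  show "0 \<le> T" "\<phi> T Var_w = \<phi> 0 Var_w" "\<phi> T Var_vlo = \<phi> 0 Var_vlo"
    using T const[of T Var_w] const[of T Var_vlo] by simp_all
  have v: "\<phi> t Var_v = \<phi> 0 Var_v + \<phi> 0 Var_ao * t" if "t \<in> {0..T}" for t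
  proof -
    \<comment> \<open>The interval is cut to \<open>{0..t}\<close> because
      \<open>zero_deriv_constant\<close> compares endpoints only.\<close>
    have "((\<lambda>\<tau>. \<phi> \<tau> Var_v - \<phi> 0 Var_ao * \<tau>) has_real_derivative 0) (at u within {0..t})"
      if "u \<in> {0..t}" for u
    proof -
      have u: "u \<in> {0..T}"
        using that \<open>t \<in> {0..T}\<close> by simp
      then have "((\<lambda>\<tau>. \<phi> \<tau> Var_v) has_real_derivative \<phi> 0 Var_ao) (at u within {0..t})"
        using DERIV_subset[OF v'[OF u], of "{0..t}"] const[OF u, of Var_ao] \<open>t \<in> {0..T}\<close>
        by simp
      then show ?thesis
        by (auto intro!: derivative_eq_intros)
    qed
    from zero_deriv_constant[OF this] that show ?thesis by simp
  qed
  show "\<phi> T Var_v = \<phi> 0 Var_v + \<phi> 0 Var_ao * T"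
    using v[of T] T by simp
  have "((\<lambda>\<tau>. \<phi> \<tau> Var_h + (\<phi> 0 Var_v * \<tau> + \<phi> 0 Var_ao / 2 * \<tau>\<^sup>2)) has_real_derivative 0)
      (at t within {0..T})" if "t \<in> {0..T}" for t
    using v[OF that] by (auto intro!: derivative_eq_intros h'[OF that])
  from zero_deriv_constant[OF this T]
  show "\<phi> T Var_h = \<phi> 0 Var_h - (\<phi> 0 Var_v * T + \<phi> 0 Var_ao / 2 * T\<^sup>2)"
    by auto
  have "((\<lambda>\<tau>. \<phi> \<tau> Var_r + rv * \<tau>) has_real_derivative 0) (at t within {0..T})"
    if "t \<in> {0..T}" for t
    by (auto intro!: derivative_eq_intros r'[OF that])
  from zero_deriv_constant[OF this T] show "\<phi> T Var_r = \<phi> 0 Var_r - rv * T"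
    by auto
qed

section \<open>The nominal trajectory and its shift in time\<close>

lemma A_lo_nonneg:
  assumes "alo > 0" "A_lo alo v w vlo hn t"
  shows "0 \<le> t"
proof -
  have "0 \<le> T_lo alo v w vlo"
    using assms(1) by (simp add: T_lo_def)
  then show ?thesis
    using assms(2) by (auto simp: A_lo_def)
qed

text \<open>Multiplying the bound on \<open>t\<close> by \<open>alo\<close> removes the division
  from the case distinction.\<close>

lemma A_lo_iff:
  assumes "alo > 0" "0 \<le> t"
  shows "A_lo alo v w vlo hn t \<longleftrightarrow>
    (if alo * t < max 0 (w * (vlo - v)) then hn = w * alo / 2 * t\<^sup>2 + v * t
     else hn = vlo * t - w * (max 0 (w * (vlo - v)))\<^sup>2 / (2 * alo))"
proof -
  have "t < T_lo alo v w vlo \<longleftrightarrow> alo * t < max 0 (w * (vlo - v))"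
    using assms by (simp add: T_lo_def pos_less_divide_eq mult.commute)
  then show ?thesis
    using assms(2) by (simp add: A_lo_def flip: not_less)
qed

text \<open>This is the instance \<open>t = 0\<close>, \<open>hn = 0\<close>: both branches of
  \<open>A_lo\<close> start at height \<open>0\<close>.\<close>

lemma L_impl_imp_separated:
  assumes "alo > 0" "w = 1 \<or> w = -1" "s Var_w = w" "L_impl rp hp rv alo s"
  shows "\<bar>s Var_r\<bar> > rp \<or> \<bar>s Var_h\<bar> > hp"
proof -
  have "A_lo alo (s Var_v) w (s Var_vlo) 0 0"
    using assms(1) by (auto simp: A_lo_def T_lo_def divide_simps max_def)
  then show ?thesis
    using assms unfolding L_impl_def by fastforce
qed

text \<open>The two sides are equal as long as the target rate is not exceeded; afterwards they differ by
  the square \<open>(alo * \<tau> - w * (vlo - v))\<^sup>2 / (2 * alo)\<close>.\<close>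

lemma A_lo_shift:
  assumes "alo > 0" "w = 1 \<or> w = -1" "0 \<le> \<tau>"
    and A: "A_lo alo (v + w * alo * \<tau>) w vlo hn t"
  obtains hn' where "A_lo alo v w vlo hn' (t + \<tau>)"
    "w * hn' \<le> w * (hn + (v * \<tau> + w * alo / 2 * \<tau>\<^sup>2))"
proof -
  have t: "0 \<le> t"
    using A_lo_nonneg[OF \<open>alo > 0\<close> A] .
  \<comment> \<open>The climb rate still missing in direction \<open>w\<close>; after time \<tau> it
    has shrunk by \<open>alo * \<tau>\<close>.\<close>
  define d where "d = w * (vlo - v)"
  have d': "w * (vlo - (v + w * alo * \<tau>)) = d - alo * \<tau>"
    using assms(2) by (auto simp: d_def algebra_simps)
  have vlo: "w * (vlo * \<tau>) = w * (v * \<tau>) + d * \<tau>"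
    by (simp add: d_def algebra_simps)
  define q where "q = d\<^sup>2 / (2 * alo)"
  define q' where "q' = (d - alo * \<tau>)\<^sup>2 / (2 * alo)"
  have q': "q' = q - d * \<tau> + alo / 2 * \<tau>\<^sup>2" "0 \<le> q'"
    using assms(1) by (simp add: q_def q'_def field_simps power2_eq_square)
      (use assms(1) in \<open>simp add: q'_def\<close>)
  have at: "0 \<le> alo * t" "0 \<le> alo * \<tau>" "0 \<le> alo * (t + \<tau>)"
    using assms t by auto
  have old: "A_lo alo v w vlo hn' (t + \<tau>) \<longleftrightarrow>
      (if alo * (t + \<tau>) < max 0 d then hn' = w * alo / 2 * (t + \<tau>)\<^sup>2 + v * (t + \<tau>)
       else hn' = vlo * (t + \<tau>) - w * (max 0 d)\<^sup>2 / (2 * alo))" for hn'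
    using assms(1,3) t by (simp add: A_lo_iff d_def)
  have new: "if alo * t < max 0 (d - alo * \<tau>) then hn = w * alo / 2 * t\<^sup>2 + (v + w * alo * \<tau>) * t
       else hn = vlo * t - w * (max 0 (d - alo * \<tau>))\<^sup>2 / (2 * alo)"
    using A assms(1) t by (simp add: A_lo_iff d')
  have passed: "A_lo alo v w vlo (vlo * (t + \<tau>) - w * q) (t + \<tau>)"
    if "0 < d" "d \<le> alo * (t + \<tau>)"
    using that by (simp add: old q_def)
  \<comment> \<open>The target rate is met at the outset, not yet at \<open>t + \<tau>\<close>,
    after \<tau> but by \<open>t + \<tau>\<close>, or by \<tau>.\<close>
  consider "d \<le> 0" | "alo * (t + \<tau>) < d"
    | "0 < d" "d \<le> alo * (t + \<tau>)" "alo * \<tau> < d" | "0 < d" "d \<le> alo * \<tau>"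
    by linarith
  then show ?thesis
  proof cases
    case 1
    have hn: "hn = vlo * t"
      using new 1 at by (simp add: max_def split: if_splits)
    \<comment> \<open>Here the two sides differ by
      \<open>alo / 2 * \<tau>\<^sup>2 - d * \<tau>\<close>, which these signs make
      nonnegative.\<close>
    have "d * \<tau> \<le> 0" "0 \<le> alo * \<tau>\<^sup>2"
      using 1 assms(1,3) by (auto simp: mult_nonpos_nonneg)
    then have "w * (vlo * (t + \<tau>)) \<le> w * (hn + (v * \<tau> + w * alo / 2 * \<tau>\<^sup>2))"
      using assms(2) vlo unfolding hn by (elim disjE) (simp_all add: algebra_simps)
    moreover have "A_lo alo v w vlo (vlo * (t + \<tau>)) (t + \<tau>)"
      using 1 at by (simp add: old max_def)
    ultimately show ?thesis
      by (rule that[rotated])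
  next
    case 2
    then have hn: "hn = w * alo / 2 * t\<^sup>2 + (v + w * alo * \<tau>) * t"
      using new at by (simp add: max_def algebra_simps split: if_splits)
    have "A_lo alo v w vlo (w * alo / 2 * (t + \<tau>)\<^sup>2 + v * (t + \<tau>)) (t + \<tau>)"
      using 2 at by (simp add: old)
    moreover have "w * alo / 2 * (t + \<tau>)\<^sup>2 + v * (t + \<tau>) = hn + (v * \<tau> + w * alo / 2 * \<tau>\<^sup>2)"
      unfolding hn by (simp add: field_simps power2_eq_square)
    ultimately show ?thesis
      using that by simp
  next
    case 3
    then have hn: "hn = vlo * t - w * q'"
      using new at by (simp add: q'_def max_def algebra_simps split: if_splits)
    have "w * (vlo * (t + \<tau>) - w * q) \<le> w * (hn + (v * \<tau> + w * alo / 2 * \<tau>\<^sup>2))"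
      using assms(2) vlo unfolding hn q' by (elim disjE) (simp_all add: algebra_simps)
    with passed 3 show ?thesis
      by (intro that) auto
  next
    case 4
    then have hn: "hn = vlo * t"
      using new at by (simp add: max_def split: if_splits)
    \<comment> \<open>The gap is exactly \<open>q'\<close>, the overshoot beyond the target
      rate.\<close>
    have "w * (vlo * (t + \<tau>) - w * q) \<le> w * (hn + (v * \<tau> + w * alo / 2 * \<tau>\<^sup>2))"
      using assms(2) vlo q' unfolding hn by (elim disjE) (simp_all add: algebra_simps)
    moreover have "d \<le> alo * (t + \<tau>)"
      using 4 at by (simp add: distrib_left)
    ultimately show ?thesis
      using passed 4 by (intro that) auto
  qed
qed

text \<open>Time \<open>t\<close> after the flow corresponds to time \<open>t + T\<close> before it.
  The horizontal distances agree, and by \<open>A_lo_shift\<close> the vertical margin in direction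
  \<open>w\<close> is at least the old one.\<close>

lemma L_impl_flow:
  assumes "alo > 0" "w = 1 \<or> w = -1" "0 \<le> T" "L_impl rp hp rv alo s"
    and "s Var_w = w" "s' Var_w = w" "s' Var_vlo = s Var_vlo"
    and "s' Var_v = s Var_v + w * alo * T"
    and "s' Var_h = s Var_h - (s Var_v * T + w * alo / 2 * T\<^sup>2)"
    and "s' Var_r = s Var_r - rv * T"
  shows "L_impl rp hp rv alo s'"
  unfolding L_impl_def
proof (intro allI impI, elim conjE)
  fix t rn hn
  assume rn: "rn = rv * t" and "A_lo alo (s' Var_v) (s' Var_w) (s' Var_vlo) hn t"
  then have "A_lo alo (s Var_v + w * alo * T) w (s Var_vlo) hn t"
    using assms by simp
  from A_lo_shift[OF assms(1,2,3) this] obtain hn' where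
    hn': "A_lo alo (s Var_v) w (s Var_vlo) hn' (t + T)"
      "w * hn' \<le> w * (hn + (s Var_v * T + w * alo / 2 * T\<^sup>2))"
    by blast
  have "\<bar>s Var_r - rv * (t + T)\<bar> > rp \<or> w * (hn' - s Var_h) > hp"
    using assms(4) hn'(1) unfolding L_impl_def assms(5) by blast
  moreover have "s' Var_r - rn = s Var_r - rv * (t + T)"
    using assms(10) rn by (simp add: algebra_simps)
  moreover have "w * (hn' - s Var_h) \<le> w * (hn - s' Var_h)"
    using hn'(2) unfolding assms(9) distrib_left right_diff_distrib by linarith
  ultimately show "\<bar>s' Var_r - rn\<bar> > rp \<or> s' Var_w * (hn - s' Var_h) > hp"
    unfolding assms(6) by fastforce
qed

section \<open>One round of the game and the theorem\<close>

lemma L_impl_adv: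
  "L_impl rp hp rv alo (s(Adv_w := a, Adv_vlo := b)) = L_impl rp hp rv alo s"
  by (simp add: L_impl_def)

lemma safe_alpha1:
  fixes rp hp rv alo amax :: real
  defines "I \<equiv> \<lambda>s. (s Var_w = 1 \<or> s Var_w = -1) \<and> L_impl rp hp rv alo s"
  assumes alo: "alo > 0" and amax: "amax \<ge> alo" and "I s"
  shows "safe I ([(Opponent, alpha1 rp hp rv alo amax)], s)"
proof -
  let ?K = "[(Opponent, Seq
       (Dual (Seq (AssignAny Var_ao) (Test (\<lambda>s. -amax \<le> s Var_ao \<and> s Var_ao \<le> amax))))
       (Evolve [Var_r \<mapsto> \<lambda>s. -rv, Var_h \<mapsto> \<lambda>s. - s Var_v, Var_v \<mapsto> \<lambda>s. s Var_ao] (\<lambda>s. True)))]"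
  \<comment> \<open>Both advisory branches end in \<open>?K\<close>. The choice
    \<open>s Var_w * alo\<close> passes the test since its absolute value is \<open>alo\<close>, at
    most \<open>amax\<close>.\<close>
  have K: "safe I (?K, s)" if "I s" for s
  proof (rule safe_Seq, rule safe_Dual, rule safe_Seq, unfold other.simps,
      rule safe_AssignAny_Ownship[where c = "s Var_w * alo"], rule safe_Test_Ownship,
      goal_cases)
    case 1
    show ?case
      using that alo amax by (auto simp: I_def)
  next
    case 2
    show ?case
    proof (rule safe_Evolve_Opponent, rule safe_end)
      fix T \<phi>
      assume *: "solution [Var_r \<mapsto> \<lambda>s. -rv, Var_h \<mapsto> \<lambda>s. - s Var_v, Var_v \<mapsto> \<lambda>s. s Var_ao]
          (\<lambda>s. True) T \<phi>" and \<phi>0: "\<phi> 0 = s(Var_ao := s Var_w * alo)"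
      have "L_impl rp hp rv alo (\<phi> T)"
        by (rule L_impl_flow[where w = "s Var_w" and s = s and T = T])
          (use that alo flow_solution[OF *] in \<open>auto simp: I_def \<phi>0\<close>)
      then show "I (\<phi> T)"
        using that flow_solution[OF *] by (auto simp: I_def \<phi>0)
    qed
  qed
  show ?thesis
    unfolding alpha1_def
  proof (rule safe_Seq, rule safe_Choice_Opponent, goal_cases)
    case 1
    show ?case
      using K[OF \<open>I s\<close>] by (rule safe_Test_Opponent)
  next
    case 2
    show ?case
      \<comment> \<open>The opponent's test itself reestablishes \<open>I\<close> for the new
        advisory; the repetition treats both values of \<open>w\<close>.\<close>
      by (rule safe_Seq, rule safe_Choice_Opponent)
        (rule safe_Assign, rule safe_Seq, rule safe_AssignAny_Opponent, rule safe_Seq,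
          rule safe_Test_Opponent, rule safe_Seq, rule safe_Assign, rule safe_Assign, rule K,
          simp add: I_def L_impl_adv)+
  qed
qed

theorem theorem3p2:
  fixes rp hp rv alo amax :: real
  shows "valid (\<lambda>s.
    rp \<ge> 0 \<and> hp > 0 \<and> rv \<ge> 0 \<and> alo > 0 \<and> (s Var_w = -1 \<or> s Var_w = 1) \<and> amax \<ge> alo \<and>
    L_impl rp hp rv alo s \<longrightarrow>
    box (Star (alpha1 rp hp rv alo amax)) (\<lambda>s. \<bar>s Var_r\<bar> > rp \<or> \<bar>s Var_h\<bar> > hp) s)"
  unfolding valid_def box_def
proof (intro allI impI, elim conjE)
  fix s :: "var state"
  assume "alo > 0" "amax \<ge> alo" "s Var_w = -1 \<or> s Var_w = 1" "L_impl rp hp rv alo s"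
  then show "\<exists>\<sigma>. winning \<sigma> ([(Opponent, Star (alpha1 rp hp rv alo amax))], s)
      (\<lambda>s. \<bar>s Var_r\<bar> > rp \<or> \<bar>s Var_h\<bar> > hp)"
    by (intro safe_imp_winning safe_Star_Opponent[OF _ safe_alpha1])
      (auto dest: L_impl_imp_separated)
qed

end
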